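(* Let $G$ be a weighted undirected graph on $N$ vertices, let $T\ge1$, and let $\boldsymbol{X}$ be a joint time-vertex process on $G$ with $T$ time-steps. If $\boldsymbol{X}$ is jointly wide-sense stationary (JWSS), then $\boldsymbol{X}$ is both time wide-sense stationary (TWSS) and vertex wide-sense stationary (VWSS).
   Context: Graph. $G$ has vertices $v_1,\dots,v_N$ and symmetric weighted adjacency matrix $\boldsymbol{W}_G$ (nonnegative weights). Its combinatorial Laplacian is $\boldsymbol{L}_G=\mathrm{diag}(\boldsymbol{W}_G\boldsymbol{1}_N)-\boldsymbol{W}_G=\boldsymbol{U}_G\boldsymbol{\Lambda}_G\boldsymbol{U}_G^*$, where $\boldsymbol{U}_G$ is the (unitary) eigenvector matrix and $\boldsymbol{\Lambda}_G=\mathrm{diag}(\lambda_1,\dots,\lambda_N)$; write $\boldsymbol{u}_n(i)=[\boldsymbol{U}_G]_{i,n}$. $(\cdot)^*$ is the conjugate transpose. For $s:\mathbb{R}_+\to\mathbb{R}$ the graph filter is $s(\boldsymbol{L}_G)=\boldsymbol{U}_G s(\boldsymbol{\Lambda}_G)\boldsymbol{U}_G^*$, and its localization at vertex $v_i$ is $\mathcal{T}^G_i s=s(\boldsymbol{L}_G)\boldsymbol{\delta}_i\in\mathbb{C}^N$, i.e. $\mathcal{T}^G_{i_1}s(i_2)=\sum_{n=1}^N s(\lambda_n)\overline{\boldsymbol{u}_n(i_1)}\boldsymbol{u}_n(i_2)$. Time. $\boldsymbol{U}_T$ is the $T\times T$ unitary Fourier basis, $[\boldsymbol{U}_T]_{t,\tau}=T^{-1/2}e^{2\pi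 j(\tau-1)t/T}$ with $j=\sqrt{-1}$; the angular frequencies are $\omega_\tau=2\pi(\tau-1)/T$, $\tau=1,\dots,T$. The time Laplacian (cycle graph) is $\boldsymbol{L}_T=\boldsymbol{U}_T\,\mathrm{diag}(1-\cos\omega_1,\dots,1-\cos\omega_T)\,\boldsymbol{U}_T^*$. For a function $\gamma:\mathbb{R}\to\mathbb{R}$, its time localization at $t_1$ is $\mathcal{T}^T_{t_1}\gamma\in\mathbb{C}^T$, $\mathcal{T}^T_{t_1}\gamma(t_2)=\frac1T\sum_{\tau=1}^T\gamma(\omega_\tau)e^{2\pi j(\tau-1)(t_2-t_1)/T}$. Joint objects. $\boldsymbol{U}_J=\boldsymbol{U}_T\otimes\boldsymbol{U}_G$ (Kronecker product). The joint Laplacian is $\boldsymbol{L}_J=\boldsymbol{L}_T\otimes\boldsymbol{I}_N+\boldsymbol{I}_T\otimes\boldsymbol{L}_G$. For $h:\mathbb{R}_+\times\mathbb{R}\to\mathbb{R}$, the joint filter is $h(\boldsymbol{L}_J)=\boldsymbol{U}_J\,h(\boldsymbol{\Lambda}_G,\boldsymbol{\Omega})\,\boldsymbol{U}_J^*$, where $h(\boldsymbol{\Lambda}_G,\boldsymbol{\Omega})$ is the $NT\times NT$ diagonal matrix with $k$-th diagonal entry $h(\lambda_n,\omega_\tau)$ for $k=N(\tau-1)+n$. Joint localization at vertex $i$ and time $t$ is $\mathcal{T}^J_{i,t}h=\mathrm{mat}\big(h(\boldsymbol{L}_J)(\boldsymbol{\delta}_t\otimes\boldsymbol{\delta}_i)\big)\in\mathbb{C}^{N\times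 T}$, where $\boldsymbol{\delta}$ denotes a Kronecker delta (standard basis vector), $\mathrm{vec}$ stacks the columns of an $N\times T$ matrix, and $\mathrm{mat}$ is the inverse of $\mathrm{vec}$. Processes. A joint time-vertex process is a random matrix $\boldsymbol{X}\in\mathbb{R}^{N\times T}$ with finite second moments; its $t$-th column is the graph signal $\boldsymbol{x}_t\in\mathbb{R}^N$, its $i$-th row (as a column vector) is the temporal signal $\boldsymbol{x}^i\in\mathbb{R}^T$, and $\boldsymbol{x}=\mathrm{vec}(\boldsymbol{X})$. For a random vector $\boldsymbol{z}$, $\boldsymbol{\Sigma}_{\boldsymbol{z}}=\mathbb{E}[\boldsymbol{z}\boldsymbol{z}^*]-\mathbb{E}[\boldsymbol{z}]\mathbb{E}[\boldsymbol{z}^*]$, and $[\boldsymbol{\Sigma}_{\boldsymbol{z}}]_{k,\cdot}$ is its $k$-th row, viewed as a vector. TWSS. $\boldsymbol{X}$ is time wide-sense stationary if for each vertex $v_i$: (1) $\mathbb{E}[\boldsymbol{x}^i]=c_i\boldsymbol{1}_T$ for some constant $c_i$; (2) there exists a function $\gamma_i$ with $[\boldsymbol{\Sigma}_{\boldsymbol{x}^i}]_{t,\cdot}=\mathcal{T}^T_t\gamma_i$ for all $t$. VWSS. $\boldsymbol{X}$ is vertex wide-sense stationary if for each time $t$: (1) $\boldsymbol{L}_G\mathbb{E}[\boldsymbol{x}_t]=\boldsymbol{0}_N$; (2) there exists a graph filter $s_t(\boldsymbol{L}_G)$ with $[\boldsymbol{\Sigma}_{\boldsymbol{x}_t}]_{i,\cdot}=\mathcal{T}^G_i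 s_t$ for all $i$. JWSS. $\boldsymbol{X}$ is jointly wide-sense stationary if: (1) $\boldsymbol{L}_J\mathbb{E}[\boldsymbol{x}]=\boldsymbol{0}_{NT}$; (2) there exists a joint filter $h(\boldsymbol{L}_J)$ with $[\boldsymbol{\Sigma}_{\boldsymbol{x}}]_{k,\cdot}=\mathrm{vec}(\mathcal{T}^J_{i,t}h)$ for all $i,t$, where $k=N(t-1)+i$. *)

theory Defs
  imports "HOL-Probability.Probability" "Jordan_Normal_Form.Schur_Decomposition"
begin

(* Both HOL-Analysis and Jordan_Normal_Form use the infix $; here it always denotes vec_index. *)
unbundle no vec_syntax

(* All indices are 0-based: vertices i < N, time steps t < T, frequencies tau < T.  Thus the
   1-based position k = N(t-1)+i of a stacked vector becomes N * t + i. *)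

definition ones_vec :: "nat \<Rightarrow> 'a :: one Matrix.vec" where
  "ones_vec n = Matrix.vec n (\<lambda>_. 1)"

definition kronecker_mat :: "'a :: times Matrix.mat \<Rightarrow> 'a Matrix.mat \<Rightarrow> 'a Matrix.mat" where
  "kronecker_mat A B =
     Matrix.mat (dim_row A * dim_row B) (dim_col A * dim_col B)
       (\<lambda>(k, l). A $$ (k div dim_row B, l div dim_col B) * B $$ (k mod dim_row B, l mod dim_col B))"

definition kronecker_vec :: "'a :: times Matrix.vec \<Rightarrow> 'a Matrix.vec \<Rightarrow> 'a Matrix.vec" where
  "kronecker_vec u v =
     Matrix.vec (dim_vec u * dim_vec v) (\<lambda>k. u $ (k div dim_vec v) * v $ (k mod dim_vec v))"

(* Column stacking, and its inverse on N x T matrices. *)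
definition vectorize :: "'a Matrix.mat \<Rightarrow> 'a Matrix.vec" where
  "vectorize A = Matrix.vec (dim_row A * dim_col A) (\<lambda>k. A $$ (k mod dim_row A, k div dim_row A))"

definition unvectorize :: "nat \<Rightarrow> nat \<Rightarrow> 'a Matrix.vec \<Rightarrow> 'a Matrix.mat" where
  "unvectorize N T v = Matrix.mat N T (\<lambda>(i, t). v $ (N * t + i))"

definition unitary_mat :: "nat \<Rightarrow> complex Matrix.mat \<Rightarrow> bool" where
  "unitary_mat n U \<longleftrightarrow>
     U \<in> carrier_mat n n \<and> U * mat_adjoint U = 1\<^sub>m n \<and> mat_adjoint U * U = 1\<^sub>m n"

definition weighted_graph :: "nat \<Rightarrow> real Matrix.mat \<Rightarrow> bool" where
  "weighted_graph N W \<longleftrightarrow>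
     W \<in> carrier_mat N N \<and> transpose_mat W = W \<and> (\<forall>i<N. \<forall>j<N. 0 \<le> W $$ (i, j))"

definition graph_laplacian :: "nat \<Rightarrow> real Matrix.mat \<Rightarrow> real Matrix.mat" where
  "graph_laplacian N W = mat_diag N (\<lambda>i. (W *\<^sub>v ones_vec N) $ i) - W"

definition graph_eigenbasis ::
    "nat \<Rightarrow> real Matrix.mat \<Rightarrow> complex Matrix.mat \<Rightarrow> (nat \<Rightarrow> real) \<Rightarrow> bool" where
  "graph_eigenbasis N W U lam \<longleftrightarrow>
     unitary_mat N U \<and>
     map_mat complex_of_real (graph_laplacian N W) =
       U * mat_diag N (\<lambda>n. complex_of_real (lam n)) * mat_adjoint U"

(* A filter s is a total function on the reals; only its values at the (nonnegative) Laplacian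
   eigenvalues lam n with n < N matter.  The same holds for the first argument of h below. *)
definition graph_filter ::
    "nat \<Rightarrow> complex Matrix.mat \<Rightarrow> (nat \<Rightarrow> real) \<Rightarrow> (real \<Rightarrow> real) \<Rightarrow> complex Matrix.mat" where
  "graph_filter N U lam s =
     U * mat_diag N (\<lambda>n. complex_of_real (s (lam n))) * mat_adjoint U"

definition graph_localization ::
    "nat \<Rightarrow> complex Matrix.mat \<Rightarrow> (nat \<Rightarrow> real) \<Rightarrow> nat \<Rightarrow> (real \<Rightarrow> real) \<Rightarrow> complex Matrix.vec" where
  "graph_localization N U lam i s = graph_filter N U lam s *\<^sub>v unit_vec N i"

definition omega :: "nat \<Rightarrow> nat \<Rightarrow> real" where
  "omega T \<tau> = 2 * pi * real \<tau> / real T"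

(* With 1-based indices the (t, tau) entry is T^(-1/2) exp (2 pi i (tau - 1) t / T): the frequency
   is shifted by one but the time is not, hence the factor t + 1 for 0-based t. *)
definition fourier_mat :: "nat \<Rightarrow> complex Matrix.mat" where
  "fourier_mat T =
     Matrix.mat T T (\<lambda>(t, \<tau>).
       exp (2 * complex_of_real pi * \<i> * of_nat \<tau> * of_nat (t + 1) / of_nat T)
         / complex_of_real (sqrt (real T)))"

definition time_laplacian :: "nat \<Rightarrow> complex Matrix.mat" where
  "time_laplacian T =
     fourier_mat T * mat_diag T (\<lambda>\<tau>. complex_of_real (1 - cos (omega T \<tau>)))
       * mat_adjoint (fourier_mat T)"

definition time_localization :: "nat \<Rightarrow> nat \<Rightarrow> (real \<Rightarrow> real) \<Rightarrow> complex Matrix.vec" where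
  "time_localization T t\<^sub>1 \<gamma> =
     Matrix.vec T (\<lambda>t\<^sub>2. 1 / of_nat T *
       (\<Sum>\<tau><T. complex_of_real (\<gamma> (omega T \<tau>)) *
          exp (2 * complex_of_real pi * \<i> * of_nat \<tau> * (of_nat t\<^sub>2 - of_nat t\<^sub>1) / of_nat T)))"

definition joint_basis :: "nat \<Rightarrow> complex Matrix.mat \<Rightarrow> complex Matrix.mat" where
  "joint_basis T U = kronecker_mat (fourier_mat T) U"

definition joint_laplacian :: "nat \<Rightarrow> nat \<Rightarrow> real Matrix.mat \<Rightarrow> complex Matrix.mat" where
  "joint_laplacian N T W =
     kronecker_mat (time_laplacian T) (1\<^sub>m N) +
     kronecker_mat (1\<^sub>m T) (map_mat complex_of_real (graph_laplacian N W))"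

definition joint_filter ::
    "nat \<Rightarrow> nat \<Rightarrow> complex Matrix.mat \<Rightarrow> (nat \<Rightarrow> real) \<Rightarrow> (real \<Rightarrow> real \<Rightarrow> real) \<Rightarrow> complex Matrix.mat"
  where
  "joint_filter N T U lam h =
     joint_basis T U
       * mat_diag (N * T) (\<lambda>k. complex_of_real (h (lam (k mod N)) (omega T (k div N))))
       * mat_adjoint (joint_basis T U)"

definition joint_localization ::
    "nat \<Rightarrow> nat \<Rightarrow> complex Matrix.mat \<Rightarrow> (nat \<Rightarrow> real) \<Rightarrow> nat \<Rightarrow> nat \<Rightarrow> (real \<Rightarrow> real \<Rightarrow> real)
      \<Rightarrow> complex Matrix.mat" where
  "joint_localization N T U lam i t h =
     unvectorize N T (joint_filter N T U lam h *\<^sub>v kronecker_vec (unit_vec T t) (unit_vec N i))"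

definition joint_process :: "nat \<Rightarrow> nat \<Rightarrow> 'a measure \<Rightarrow> ('a \<Rightarrow> real Matrix.mat) \<Rightarrow> bool" where
  "joint_process N T M X \<longleftrightarrow>
     prob_space M \<and>
     (\<forall>\<omega>\<in>space M. X \<omega> \<in> carrier_mat N T) \<and>
     (\<forall>i<N. \<forall>t<T. (\<lambda>\<omega>. X \<omega> $$ (i, t)) \<in> borel_measurable M \<and>
                   integrable M (\<lambda>\<omega>. (X \<omega> $$ (i, t))\<^sup>2))"

definition mean_vec :: "nat \<Rightarrow> 'a measure \<Rightarrow> ('a \<Rightarrow> real Matrix.vec) \<Rightarrow> real Matrix.vec" where
  "mean_vec n M z = Matrix.vec n (\<lambda>k. \<integral>\<omega>. z \<omega> $ k \<partial>M)"

(* E[z z*] - E[z] E[z*] entrywise, for a real random vector z of dimension n. *)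
definition covariance_mat :: "nat \<Rightarrow> 'a measure \<Rightarrow> ('a \<Rightarrow> real Matrix.vec) \<Rightarrow> real Matrix.mat" where
  "covariance_mat n M z =
     Matrix.mat n n (\<lambda>(k, l).
       (\<integral>\<omega>. z \<omega> $ k * z \<omega> $ l \<partial>M) - (\<integral>\<omega>. z \<omega> $ k \<partial>M) * (\<integral>\<omega>. z \<omega> $ l \<partial>M))"

definition TWSS :: "nat \<Rightarrow> nat \<Rightarrow> 'a measure \<Rightarrow> ('a \<Rightarrow> real Matrix.mat) \<Rightarrow> bool" where
  "TWSS N T M X \<longleftrightarrow>
     (\<forall>i<N.
        (\<exists>c. mean_vec T M (\<lambda>\<omega>. Matrix.row (X \<omega>) i) = c \<cdot>\<^sub>v ones_vec T) \<and>
        (\<exists>\<gamma>. \<forall>t<T.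
           map_vec complex_of_real
             (Matrix.row (covariance_mat T M (\<lambda>\<omega>. Matrix.row (X \<omega>) i)) t) =
           time_localization T t \<gamma>))"

definition VWSS ::
    "nat \<Rightarrow> nat \<Rightarrow> real Matrix.mat \<Rightarrow> complex Matrix.mat \<Rightarrow> (nat \<Rightarrow> real) \<Rightarrow>
      'a measure \<Rightarrow> ('a \<Rightarrow> real Matrix.mat) \<Rightarrow> bool" where
  "VWSS N T W U lam M X \<longleftrightarrow>
     (\<forall>t<T.
        graph_laplacian N W *\<^sub>v mean_vec N M (\<lambda>\<omega>. col (X \<omega>) t) = 0\<^sub>v N \<and>
        (\<exists>s. \<forall>i<N.
           map_vec complex_of_real
             (Matrix.row (covariance_mat N M (\<lambda>\<omega>. col (X \<omega>) t)) i) =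
           graph_localization N U lam i s))"

definition JWSS ::
    "nat \<Rightarrow> nat \<Rightarrow> real Matrix.mat \<Rightarrow> complex Matrix.mat \<Rightarrow> (nat \<Rightarrow> real) \<Rightarrow>
      'a measure \<Rightarrow> ('a \<Rightarrow> real Matrix.mat) \<Rightarrow> bool" where
  "JWSS N T W U lam M X \<longleftrightarrow>
     joint_laplacian N T W *\<^sub>v
       map_vec complex_of_real (mean_vec (N * T) M (\<lambda>\<omega>. vectorize (X \<omega>))) = 0\<^sub>v (N * T) \<and>
     (\<exists>h. \<forall>i<N. \<forall>t<T.
        map_vec complex_of_real
          (Matrix.row (covariance_mat (N * T) M (\<lambda>\<omega>. vectorize (X \<omega>))) (N * t + i)) =
        vectorize (joint_localization N T U lam i t h))"

end

(* Covariance: the joint filter has a product eigenbasis, so fixing a vertex i leaves a time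
   localization with gamma(w) = sum_n h(lambda_n, w) |u_n(i)|^2, and fixing a time leaves a graph
   localization with s(l) = (1/T) sum_tau h(l, omega_tau).  Mean: the quadratic form of L_J at E[x]
   is a sum of quadratic forms of L_T along the rows and of L_G along the columns.  All of them are
   nonnegative, hence zero.  By Fourier inversion the rows are then constant; in the columns every
   term W_ij (x_i - x_j)^2 vanishes, so L_G annihilates them. *)
theory Submission
  imports Defs
begin

section \<open>Stacked indices and entries of spectral products\<close>

lemma sum_lessThan_mult:
  fixes f :: "nat \<Rightarrow> 'b :: comm_monoid_add"
  shows "(\<Sum>k<N * T. f k) = (\<Sum>t<T. \<Sum>i<N. f (N * t + i))"
proof -
  \<comment> \<open>The range is cut into \<open>T\<close> consecutive blocks of length
    \<open>N\<close>; each block is then shifted to start at 0.\<close>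
  have "(\<Sum>k<N * T. f k) = (\<Sum>t<T. sum f {t * N..<t * N + N})"
    by (simp add: sum.nat_group mult.commute)
  also have "\<dots> = (\<Sum>t<T. \<Sum>i<N. f (N * t + i))"
  proof (rule sum.cong[OF refl])
    fix t
    show "sum f {t * N..<t * N + N} = (\<Sum>i<N. f (N * t + i))"
      using sum.shift_bounds_nat_ivl[of f 0 "t * N" N]
      by (simp add: atLeast0LessThan add.commute mult.commute)
  qed
  finally show ?thesis .
qed

lemma stacked_index_less: "N * t + i < N * T" if "i < N" "t < T" for N T i t :: nat
proof -
  have "N * t + i < N * Suc t" using that by simp
  also have "\<dots> \<le> N * T" using that by (intro mult_le_mono2) simp
  finally show ?thesis .
qed

text \<open>The time Laplacian, the graph filter and the joint filter are all products of this
  shape, so this one formula gives the entries of all three.\<close>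

lemma spectral_entry:
  fixes A :: "complex Matrix.mat"
  assumes "A \<in> carrier_mat n n" "i < n" "j < n"
  shows "(A * mat_diag n d * mat_adjoint A) $$ (i, j) =
           (\<Sum>k<n. d k * A $$ (i, k) * cnj (A $$ (j, k)))"
  using assms
  by (simp add: mat_diag_mult_right scalar_prod_def mat_adjoint_def mat_of_rows_def
      atLeast0LessThan mult.commute)

lemma mult_mat_unit_vec_index:
  fixes A :: "'b :: semiring_1 Matrix.mat"
  assumes "A \<in> carrier_mat m n" "i < m" "j < n"
  shows "(A *\<^sub>v unit_vec n j) $ i = A $$ (i, j)"
  using assms by simp

lemma kronecker_unit_vec:
  assumes "t < T" "i < N"
  shows "kronecker_vec (unit_vec T t) (unit_vec N i) =
           (unit_vec (N * T) (N * t + i) :: 'b :: semiring_1 Matrix.vec)"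
proof (rule eq_vecI)
  fix k assume "k < dim_vec (unit_vec (N * T) (N * t + i) :: 'b Matrix.vec)"
  then have k: "k < N * T" by simp
  then have b: "k div N < T" "k mod N < N"
    using assms by (auto simp: less_mult_imp_div_less mult.commute)
  \<comment> \<open>Uniqueness of quotient and remainder modulo \<open>N\<close>, as
    \<open>i < N\<close>: the two deltas together pick exactly one stacked position.\<close>
  have "k = N * t + i \<longleftrightarrow> k div N = t \<and> k mod N = i"
    using assms(2) by auto
  then show "kronecker_vec (unit_vec T t) (unit_vec N i) $ k =
      (unit_vec (N * T) (N * t + i) :: 'b Matrix.vec) $ k"
    using k b stacked_index_less[OF assms(2,1)] assms
    by (auto simp: kronecker_vec_def mult.commute)
qed (simp add: kronecker_vec_def mult.commute)

section \<open>The Fourier basis and its inversion\<close>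

lemma fourier_mat_carrier [simp]: "fourier_mat T \<in> carrier_mat T T"
  by (simp add: fourier_mat_def)

text \<open>The exponents are purely imaginary, so conjugation negates them, and the shifts
  \<open>t + 1\<close> and \<open>s + 1\<close> cancel. Only the time difference survives, which is
  the source of stationarity in time.\<close>

lemma fourier_entry_mult_cnj:
  assumes "t < T" "s < T" "\<tau> < T"
  shows "fourier_mat T $$ (t, \<tau>) * cnj (fourier_mat T $$ (s, \<tau>)) =
           exp (2 * complex_of_real pi * \<i> * of_nat \<tau> * (of_nat t - of_nat s) / of_nat T) / of_nat T"
proof -
  define a where "a r = 2 * complex_of_real pi * \<i> * of_nat \<tau> * of_nat (r + 1) / of_nat T" for r
  have "cnj (exp (a s)) = exp (- a s)"
    by (simp add: a_def exp_cnj)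
  then have "exp (a t) * cnj (exp (a s)) = exp (a t - a s)"
    by (simp add: exp_diff exp_minus divide_inverse)
  also have "a t - a s = 2 * complex_of_real pi * \<i> * of_nat \<tau> * (of_nat (t + 1) - of_nat (s + 1)) / of_nat T"
    by (simp only: a_def right_diff_distrib diff_divide_distrib)
  finally have "exp (a t) * cnj (exp (a s)) =
      exp (2 * complex_of_real pi * \<i> * of_nat \<tau> * (of_nat t - of_nat s) / of_nat T)"
    by simp
  moreover have "complex_of_real (sqrt (real T)) * complex_of_real (sqrt (real T)) = of_nat T"
    by (metis of_real_mult of_real_of_nat_eq of_nat_0_le_iff real_sqrt_mult_self abs_of_nonneg)
  ultimately show ?thesis
    using assms by (simp add: fourier_mat_def a_def)
qed

text \<open>The sum is a geometric series in a \<open>T\<close>-th root of unity \<open>z\<close>.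
  It vanishes unless \<open>z = 1\<close>, and that would make \<open>t - s\<close> a multiple of
  \<open>T\<close>.\<close>

lemma fourier_rows_orthonormal:
  assumes "t < T" "s < T"
  shows "(\<Sum>\<tau><T. fourier_mat T $$ (t, \<tau>) * cnj (fourier_mat T $$ (s, \<tau>))) =
           (if t = s then 1 else 0)"
proof -
  define z where "z = exp (2 * complex_of_real pi * \<i> * (of_nat t - of_nat s) / of_nat T)"
  have T: "T > 0" using assms by simp
  have sum: "(\<Sum>\<tau><T. fourier_mat T $$ (t, \<tau>) * cnj (fourier_mat T $$ (s, \<tau>))) =
      (\<Sum>\<tau><T. z ^ \<tau>) / of_nat T"
    unfolding sum_divide_distrib
  proof (rule sum.cong[OF refl])
    fix \<tau> assume "\<tau> \<in> {..<T}"
    then show "fourier_mat T $$ (t, \<tau>) * cnj (fourier_mat T $$ (s, \<tau>)) = z ^ \<tau> / of_nat T"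
      using assms by (simp add: fourier_entry_mult_cnj z_def exp_of_nat_mult [symmetric] mult_ac)
  qed
  show ?thesis
  proof (cases "t = s")
    case True
    then show ?thesis using T unfolding sum by (simp add: z_def)
  next
    case False
    have "z ^ T = exp (2 * complex_of_real pi * \<i> * of_int (int t - int s))"
      using T by (simp add: z_def exp_of_nat_mult [symmetric])
    also have "\<dots> = 1"
      by (subst exp_eq_1) (auto intro!: exI[of _ "int t - int s"])
    finally have zT: "z ^ T = 1" .
    have "z \<noteq> 1"
    proof
      assume "z = 1"
      then obtain n :: int where n: "2 * pi * (real t - real s) / real T = of_int (2 * n) * pi"
        unfolding z_def exp_eq_1 by (auto simp: Im_divide_of_nat)
      then have "(2 * pi) * (real t - real s) = (2 * pi) * (of_int n * real T)"
        using T by (simp add: divide_eq_eq mult_ac)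
      then have "real t - real s = of_int n * real T"
        by simp
      then have eq: "int t - int s = n * int T"
        by (metis of_int_diff of_int_eq_iff of_int_mult of_int_of_nat_eq)
      \<comment> \<open>Two indices below \<open>T\<close> differ by less than \<open>T\<close>, so
        the only multiple of \<open>T\<close> available is 0.\<close>
      have "\<bar>int t - int s\<bar> < int T" using assms by simp
      then have "n = 0" unfolding eq using T by (simp add: abs_mult)
      then show False using eq False by simp
    qed
    then show ?thesis using False zT by (simp add: sum geometric_sum)
  qed
qed

text \<open>This makes 0 a simple eigenvalue of the time Laplacian: a cosine equal to 1 would force
  \<open>\<tau>\<close> to be a positive multiple of \<open>T\<close>.\<close>

lemma cos_omega_less_1:
  assumes "0 < \<tau>" "\<tau> < T"
  shows "cos (omega T \<tau>) < 1"
proof -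
  have "cos (omega T \<tau>) \<noteq> 1"
  proof
    assume "cos (omega T \<tau>) = 1"
    then obtain n :: int where "omega T \<tau> = of_int n * 2 * pi"
      unfolding cos_one_2pi_int by auto
    then have "real \<tau> = of_int n * real T"
      using assms by (simp add: omega_def field_simps)
    then have eq: "int \<tau> = n * int T"
      by (metis of_int_eq_iff of_int_mult of_int_of_nat_eq)
    then have "0 < n" using assms
      by (metis of_nat_0_less_iff zero_less_mult_pos2 less_trans)
    then have "int T \<le> int \<tau>" unfolding eq using assms by simp
    then show False using assms by simp
  qed
  then show ?thesis by (simp add: order.not_eq_order_implies_strict)
qed

text \<open>An entry of the adjoint Fourier matrix applied to a real signal. The signal is a
  function rather than a vector so that a row of a stacked vector can be passed directly.\<close>

definition fourier_coeff :: "nat \<Rightarrow> (nat \<Rightarrow> real) \<Rightarrow> nat \<Rightarrow> complex" where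
  "fourier_coeff T y \<tau> = (\<Sum>s<T. cnj (fourier_mat T $$ (s, \<tau>)) * of_real (y s))"

text \<open>After exchanging the two sums, orthonormality of the rows leaves only the term
  \<open>s = t\<close>.\<close>

lemma fourier_inversion:
  assumes "t < T"
  shows "complex_of_real (y t) = (\<Sum>\<tau><T. fourier_mat T $$ (t, \<tau>) * fourier_coeff T y \<tau>)"
proof -
  have "(\<Sum>\<tau><T. fourier_mat T $$ (t, \<tau>) * fourier_coeff T y \<tau>) =
      (\<Sum>s<T. (\<Sum>\<tau><T. fourier_mat T $$ (t, \<tau>) * cnj (fourier_mat T $$ (s, \<tau>))) * of_real (y s))"
    unfolding fourier_coeff_def sum_distrib_left sum_distrib_right
    by (subst sum.swap) (simp add: mult_ac)
  also have "\<dots> = (\<Sum>s<T. if t = s then of_real (y s) else 0)"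
    using assms by (intro sum.cong) (auto simp: fourier_rows_orthonormal)
  also have "\<dots> = of_real (y t)"
    using assms by simp
  finally show ?thesis by simp
qed

section \<open>The quadratic form of the time Laplacian\<close>

lemma time_laplacian_carrier [simp]: "time_laplacian T \<in> carrier_mat T T"
  unfolding time_laplacian_def by (auto simp: fourier_mat_def mat_diag_def mat_adjoint_def mat_of_rows_def)

text \<open>In Fourier coordinates the Laplacian is diagonal with eigenvalues
  \<open>1 - cos (omega T \<tau>)\<close>. Writing the result as an embedded real number makes its
  sign available although the matrix is complex.\<close>

lemma time_laplacian_quadratic_form:
  "(\<Sum>t<T. of_real (y t) * (\<Sum>s<T. time_laplacian T $$ (t, s) * of_real (y s))) =
     complex_of_real (\<Sum>\<tau><T. (1 - cos (omega T \<tau>)) * (cmod (fourier_coeff T y \<tau>))\<^sup>2)"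
proof -
  let ?F = "fourier_mat T"
  let ?d = "\<lambda>\<tau>. complex_of_real (1 - cos (omega T \<tau>))"
  have "(\<Sum>t<T. of_real (y t) * (\<Sum>s<T. time_laplacian T $$ (t, s) * of_real (y s))) =
      (\<Sum>t<T. \<Sum>s<T. \<Sum>\<tau><T. ?d \<tau> * (?F $$ (t, \<tau>) * of_real (y t)) *
         (cnj (?F $$ (s, \<tau>)) * of_real (y s)))"
    unfolding time_laplacian_def sum_distrib_left
    by (intro sum.cong refl)
       (simp add: spectral_entry sum_distrib_left sum_distrib_right mult_ac del: of_real_diff)
  also have "\<dots> = (\<Sum>t<T. \<Sum>\<tau><T. \<Sum>s<T. ?d \<tau> * (?F $$ (t, \<tau>) * of_real (y t)) *
         (cnj (?F $$ (s, \<tau>)) * of_real (y s)))"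
    by (intro sum.cong refl sum.swap)
  also have "\<dots> = (\<Sum>\<tau><T. \<Sum>t<T. \<Sum>s<T. ?d \<tau> * (?F $$ (t, \<tau>) * of_real (y t)) *
         (cnj (?F $$ (s, \<tau>)) * of_real (y s)))"
    by (rule sum.swap)
  \<comment> \<open>With the frequency outermost, the sums over \<open>t\<close> and
    \<open>s\<close> separate. Since \<open>y\<close> is real, the one over \<open>t\<close> is the
    conjugate of the coefficient.\<close>
  also have "\<dots> = (\<Sum>\<tau><T. ?d \<tau> * (cnj (fourier_coeff T y \<tau>) * fourier_coeff T y \<tau>))"
    unfolding fourier_coeff_def cnj_sum sum_product
    by (simp add: sum_distrib_left mult_ac del: of_real_diff)
  also have "\<dots> = complex_of_real (\<Sum>\<tau><T. (1 - cos (omega T \<tau>)) * (cmod (fourier_coeff T y \<tau>))\<^sup>2)"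
    by (simp add: complex_norm_square mult.commute del: of_real_power)
  finally show ?thesis .
qed

lemma time_laplacian_quadratic_form_nonneg:
  "0 \<le> (\<Sum>\<tau><T. (1 - cos (omega T \<tau>)) * (cmod (fourier_coeff T y \<tau>))\<^sup>2)"
  by (intro sum_nonneg mult_nonneg_nonneg) auto

text \<open>Every summand is nonnegative and hence zero. Positive frequencies have positive
  eigenvalues, so their coefficients vanish and only the constant component remains.\<close>

lemma time_laplacian_quadratic_form_zero:
  assumes "(\<Sum>\<tau><T. (1 - cos (omega T \<tau>)) * (cmod (fourier_coeff T y \<tau>))\<^sup>2) = 0" "t < T"
  shows "y t = y 0"
proof -
  have coeff: "fourier_coeff T y \<tau> = 0" if "0 < \<tau>" "\<tau> < T" for \<tau>
  proof -
    have "(1 - cos (omega T \<tau>)) * (cmod (fourier_coeff T y \<tau>))\<^sup>2 = 0"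
      using assms(1) that by (subst (asm) sum_nonneg_eq_0_iff) auto
    then show ?thesis using cos_omega_less_1[OF that] by simp
  qed
  have T: "0 < T" using assms(2) by simp
  have "complex_of_real (y s) = fourier_coeff T y 0 / complex_of_real (sqrt (real T))" if "s < T" for s
  proof -
    \<comment> \<open>At frequency 0 the exponential is 1 whatever the time, so the remaining term
      does not depend on \<open>s\<close>.\<close>
    have "complex_of_real (y s) = (\<Sum>\<tau>\<in>{0}. fourier_mat T $$ (s, \<tau>) * fourier_coeff T y \<tau>)"
      unfolding fourier_inversion[OF that]
      by (rule sum.mono_neutral_right) (use T coeff in auto)
    then show ?thesis using that by (simp add: fourier_mat_def)
  qed
  from this[OF assms(2)] this[OF T] show ?thesis
    by (metis of_real_eq_iff)
qed

section \<open>The quadratic form of the graph Laplacian\<close>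

lemma graph_laplacian_carrier:
  "weighted_graph N W \<Longrightarrow> graph_laplacian N W \<in> carrier_mat N N"
  by (auto simp: graph_laplacian_def weighted_graph_def)

text \<open>The diagonal holds the row sums of \<open>W\<close>, so the degree times
  \<open>x i\<close> can be distributed over the neighbours, leaving differences.\<close>

lemma graph_laplacian_apply:
  assumes "weighted_graph N W" "i < N"
  shows "(\<Sum>j<N. graph_laplacian N W $$ (i, j) * x j) = (\<Sum>j<N. W $$ (i, j) * (x i - x j))"
proof -
  have W: "W \<in> carrier_mat N N" using assms by (simp add: weighted_graph_def)
  have "(\<Sum>j<N. graph_laplacian N W $$ (i, j) * x j) =
      (\<Sum>j<N. (if i = j then (\<Sum>k<N. W $$ (i, k)) * x i else 0) - W $$ (i, j) * x j)"
    using W assms(2)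
    by (intro sum.cong refl)
       (auto simp: graph_laplacian_def mat_diag_def ones_vec_def scalar_prod_def
         atLeast0LessThan algebra_simps)
  also have "\<dots> = (\<Sum>k<N. W $$ (i, k)) * x i - (\<Sum>j<N. W $$ (i, j) * x j)"
    using assms(2) by (simp add: sum_subtractf)
  finally show ?thesis
    by (simp add: sum_subtractf algebra_simps sum_distrib_left)
qed

lemma graph_laplacian_quadratic_form:
  assumes "weighted_graph N W"
  shows "(\<Sum>i<N. x i * (\<Sum>j<N. graph_laplacian N W $$ (i, j) * x j)) =
           (\<Sum>i<N. \<Sum>j<N. W $$ (i, j) * (x i - x j)\<^sup>2) / 2"
proof -
  let ?S = "\<Sum>i<N. \<Sum>j<N. W $$ (i, j) * (x i - x j) * x i"
  have sym: "W $$ (j, i) = W $$ (i, j)" if "i < N" "j < N" for i j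
    using assms that unfolding weighted_graph_def
    by (metis carrier_matD index_transpose_mat(1))
  have "(\<Sum>i<N. x i * (\<Sum>j<N. graph_laplacian N W $$ (i, j) * x j)) = ?S"
    by (intro sum.cong refl)
       (simp only: lessThan_iff graph_laplacian_apply[OF assms], simp add: sum_distrib_left mult_ac)
  \<comment> \<open>Exchanging the roles of \<open>i\<close> and \<open>j\<close> is harmless by
    symmetry of \<open>W\<close>. Adding both versions of \<open>?S\<close> completes the square,
    whence the factor 1/2.\<close>
  moreover have "?S = (\<Sum>i<N. \<Sum>j<N. W $$ (i, j) * (x j - x i) * x j)"
    by (subst sum.swap) (simp add: sym)
  then have "2 * ?S = (\<Sum>i<N. \<Sum>j<N. W $$ (i, j) * (x i - x j) * x i + W $$ (i, j) * (x j - x i) * x j)"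
    by (simp add: sum.distrib)
  then have "2 * ?S = (\<Sum>i<N. \<Sum>j<N. W $$ (i, j) * (x i - x j)\<^sup>2)"
    by (simp add: power2_eq_square algebra_simps)
  ultimately show ?thesis by simp
qed

lemma graph_laplacian_quadratic_form_nonneg:
  assumes "weighted_graph N W"
  shows "0 \<le> (\<Sum>i<N. x i * (\<Sum>j<N. graph_laplacian N W $$ (i, j) * x j))"
  unfolding graph_laplacian_quadratic_form[OF assms]
  using assms by (auto simp: weighted_graph_def intro!: sum_nonneg)

text \<open>Each pair has zero weight or equal values, so in the difference form of the Laplacian
  every term is zero. Values may still differ between connected components.\<close>

lemma graph_laplacian_quadratic_form_zero:
  assumes "weighted_graph N W"
    and "(\<Sum>i<N. x i * (\<Sum>j<N. graph_laplacian N W $$ (i, j) * x j)) = 0" and "i < N"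
  shows "(\<Sum>j<N. graph_laplacian N W $$ (i, j) * x j) = 0"
proof -
  have nonneg: "0 \<le> W $$ (k, j)" if "k < N" "j < N" for k j
    using assms(1) that by (simp add: weighted_graph_def)
  have "(\<Sum>i<N. \<Sum>j<N. W $$ (i, j) * (x i - x j)\<^sup>2) = 0"
    using assms(2) unfolding graph_laplacian_quadratic_form[OF assms(1)] by simp
  then have "(\<Sum>j<N. W $$ (i, j) * (x i - x j)\<^sup>2) = 0"
    using assms(3) nonneg by (subst (asm) sum_nonneg_eq_0_iff) (auto intro!: sum_nonneg)
  then have "W $$ (i, j) * (x i - x j)\<^sup>2 = 0" if "j < N" for j
    using assms(3) nonneg that by (subst (asm) sum_nonneg_eq_0_iff) auto
  then show ?thesis
    unfolding graph_laplacian_apply[OF assms(1,3)] by (auto intro!: sum.neutral)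
qed

section \<open>The joint Laplacian and its kernel\<close>

lemma joint_laplacian_apply:
  assumes "weighted_graph N W" "m \<in> carrier_vec (N * T)" "i < N" "t < T"
  shows "(joint_laplacian N T W *\<^sub>v map_vec complex_of_real m) $ (N * t + i) =
     (\<Sum>s<T. time_laplacian T $$ (t, s) * of_real (m $ (N * s + i))) +
     of_real (\<Sum>j<N. graph_laplacian N W $$ (i, j) * m $ (N * t + j))"
proof -
  have dims [simp]: "dim_row (time_laplacian T) = T" "dim_col (time_laplacian T) = T"
     "dim_row (graph_laplacian N W) = N" "dim_col (graph_laplacian N W) = N" "dim_vec m = N * T"
    using carrier_matD[OF time_laplacian_carrier[of T]] graph_laplacian_carrier[OF assms(1)] assms(2)
    by auto
  have idx: "N * s + j < N * T" if "j < N" "s < T" for s j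
    using that by (rule stacked_index_less)
  \<comment> \<open>The identity factors become Kronecker deltas: the time part never mixes vertices
    and the graph part never mixes times.\<close>
  have entry: "joint_laplacian N T W $$ (N * t + i, N * s + j) =
      (if i = j then time_laplacian T $$ (t, s) else 0) +
      (if t = s then of_real (graph_laplacian N W $$ (i, j)) else 0)" if "j < N" "s < T" for s j
    using that assms(3,4) idx[OF that] idx[OF assms(3,4)]
    by (simp add: joint_laplacian_def kronecker_mat_def mult.commute[of T N])
  have "(joint_laplacian N T W *\<^sub>v map_vec complex_of_real m) $ (N * t + i) =
      (\<Sum>l<N * T. joint_laplacian N T W $$ (N * t + i, l) * of_real (m $ l))"
    using idx[OF assms(3,4)]
    by (simp add: joint_laplacian_def kronecker_mat_def scalar_prod_def atLeast0LessThan mult.commute)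
  also have "\<dots> = (\<Sum>s<T. \<Sum>j<N. joint_laplacian N T W $$ (N * t + i, N * s + j) * of_real (m $ (N * s + j)))"
    by (rule sum_lessThan_mult)
  also have "\<dots> = (\<Sum>s<T. \<Sum>j<N.
      (if i = j then time_laplacian T $$ (t, s) * of_real (m $ (N * s + j)) else 0) +
      (if t = s then of_real (graph_laplacian N W $$ (i, j) * m $ (N * s + j)) else 0))"
    by (intro sum.cong refl) (simp add: entry distrib_right)
  \<comment> \<open>The second double sum is reordered so that in both the inner index is the one
    fixed by the delta.\<close>
  also have "\<dots> = (\<Sum>s<T. time_laplacian T $$ (t, s) * of_real (m $ (N * s + i))) +
      (\<Sum>j<N. \<Sum>s<T. if t = s then of_real (graph_laplacian N W $$ (i, j) * m $ (N * s + j)) else 0)"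
    unfolding sum.distrib using assms(3) by (subst (3) sum.swap) simp
  finally show ?thesis using assms(4) by simp
qed

text \<open>Entrywise the equation only says that a time part and a graph part cancel. Pairing it
  with \<open>m\<close> turns both into sums of nonnegative forms, so neither can compensate the
  other and each single form is zero.\<close>

lemma joint_laplacian_kernel:
  assumes W: "weighted_graph N W" and m: "m \<in> carrier_vec (N * T)"
    and zero: "joint_laplacian N T W *\<^sub>v map_vec complex_of_real m = 0\<^sub>v (N * T)"
    and i: "i < N" and t: "t < T"
  shows "m $ (N * t + i) = m $ i"
    and "(\<Sum>j<N. graph_laplacian N W $$ (i, j) * m $ (N * t + j)) = 0"
proof -
  let ?p = "\<lambda>i t. m $ (N * t + i)"
  let ?q = "\<lambda>i. \<Sum>\<tau><T. (1 - cos (omega T \<tau>)) * (cmod (fourier_coeff T (?p i) \<tau>))\<^sup>2"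
  let ?g = "\<lambda>t. \<Sum>i<N. ?p i t * (\<Sum>j<N. graph_laplacian N W $$ (i, j) * ?p j t)"
  have eq: "(\<Sum>s<T. time_laplacian T $$ (t, s) * of_real (?p i s)) +
      of_real (\<Sum>j<N. graph_laplacian N W $$ (i, j) * ?p j t) = 0" if "i < N" "t < T" for i t
    using joint_laplacian_apply[OF W m that] stacked_index_less[OF that] by (simp add: zero)
  have "0 = (\<Sum>i<N. \<Sum>t<T. of_real (?p i t) * ((\<Sum>s<T. time_laplacian T $$ (t, s) * of_real (?p i s)) +
      of_real (\<Sum>j<N. graph_laplacian N W $$ (i, j) * ?p j t)))"
    by (simp add: eq del: of_real_sum)
  also have "\<dots> = (\<Sum>i<N. \<Sum>t<T. of_real (?p i t) * (\<Sum>s<T. time_laplacian T $$ (t, s) * of_real (?p i s))) +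
      of_real (\<Sum>i<N. \<Sum>t<T. ?p i t * (\<Sum>j<N. graph_laplacian N W $$ (i, j) * ?p j t))"
    by (simp add: distrib_left sum.distrib)
  also have "(\<Sum>i<N. \<Sum>t<T. ?p i t * (\<Sum>j<N. graph_laplacian N W $$ (i, j) * ?p j t)) = (\<Sum>t<T. ?g t)"
    by (rule sum.swap)
  also have "(\<Sum>i<N. \<Sum>t<T. of_real (?p i t) * (\<Sum>s<T. time_laplacian T $$ (t, s) * of_real (?p i s))) =
      complex_of_real (\<Sum>i<N. ?q i)"
    unfolding time_laplacian_quadratic_form of_real_sum[of ?q] by (rule refl)
  finally have "complex_of_real ((\<Sum>i<N. ?q i) + (\<Sum>t<T. ?g t)) = 0"
    by (simp only: of_real_add)
  then have "(\<Sum>i<N. ?q i) + (\<Sum>t<T. ?g t) = 0"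
    by (simp only: of_real_eq_0_iff)
  moreover have "0 \<le> (\<Sum>i<N. ?q i)" "0 \<le> (\<Sum>t<T. ?g t)"
    by (intro sum_nonneg time_laplacian_quadratic_form_nonneg
        graph_laplacian_quadratic_form_nonneg[OF W])+
  ultimately have "(\<Sum>i<N. ?q i) = 0" "(\<Sum>t<T. ?g t) = 0"
    by linarith+
  then have q: "?q i = 0" and g: "?g t = 0"
    using i t
      sum_nonneg_eq_0_iff[of "{..<N}" ?q, OF finite_lessThan time_laplacian_quadratic_form_nonneg]
      sum_nonneg_eq_0_iff[of "{..<T}" ?g, OF finite_lessThan graph_laplacian_quadratic_form_nonneg[OF W]]
    by blast+
  \<comment> \<open>\<open>m $ i\<close> is the entry of row \<open>i\<close> at time 0, because
    \<open>N * 0 + i = i\<close>.\<close>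
  show "m $ (N * t + i) = m $ i"
    using time_laplacian_quadratic_form_zero[OF q t] by simp
  show "(\<Sum>j<N. graph_laplacian N W $$ (i, j) * m $ (N * t + j)) = 0"
    by (rule graph_laplacian_quadratic_form_zero[OF W g i])
qed

section \<open>Entries of the joint filter and of its localizations\<close>

lemma joint_basis_carrier:
  "U \<in> carrier_mat N N \<Longrightarrow> joint_basis T U \<in> carrier_mat (N * T) (N * T)"
  by (simp add: joint_basis_def kronecker_mat_def fourier_mat_def mult.commute)

lemma joint_basis_entry:
  assumes "U \<in> carrier_mat N N" "i < N" "n < N" "t < T" "\<tau> < T"
  shows "joint_basis T U $$ (N * t + i, N * \<tau> + n) = fourier_mat T $$ (t, \<tau>) * U $$ (i, n)"
  using assms stacked_index_less[of i N t T] stacked_index_less[of n N \<tau> T] fourier_mat_carrier[of T]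
  by (simp add: joint_basis_def kronecker_mat_def mult.commute[of T N] carrier_matD[OF fourier_mat_carrier])

lemma joint_filter_carrier:
  assumes "U \<in> carrier_mat N N"
  shows "joint_filter N T U lam h \<in> carrier_mat (N * T) (N * T)"
  using carrier_matD[OF joint_basis_carrier[OF assms, of T]]
  by (intro carrier_matI) (simp_all add: joint_filter_def mat_adjoint_def mat_of_rows_def)

text \<open>Writing the spectral index as \<open>N * \<tau> + n\<close> splits each eigenvector into
  a time factor and a vertex factor. Fixing the vertex or the time then simplifies one of the two
  factors.\<close>

lemma joint_filter_entry:
  assumes "U \<in> carrier_mat N N" "i < N" "j < N" "t < T" "s < T"
  shows "joint_filter N T U lam h $$ (N * t + i, N * s + j) =
    (\<Sum>\<tau><T. \<Sum>n<N. of_real (h (lam n) (omega T \<tau>)) *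
       (fourier_mat T $$ (t, \<tau>) * cnj (fourier_mat T $$ (s, \<tau>))) *
       (U $$ (i, n) * cnj (U $$ (j, n))))"
proof -
  have "joint_filter N T U lam h $$ (N * t + i, N * s + j) =
      (\<Sum>k<N * T. of_real (h (lam (k mod N)) (omega T (k div N))) *
        joint_basis T U $$ (N * t + i, k) * cnj (joint_basis T U $$ (N * s + j, k)))"
    unfolding joint_filter_def
    using assms by (intro spectral_entry joint_basis_carrier stacked_index_less)
  also have "\<dots> = (\<Sum>\<tau><T. \<Sum>n<N. of_real (h (lam n) (omega T \<tau>)) *
        (fourier_mat T $$ (t, \<tau>) * U $$ (i, n)) * cnj (fourier_mat T $$ (s, \<tau>) * U $$ (j, n)))"
    unfolding sum_lessThan_mult
    by (intro sum.cong refl) (use assms in \<open>simp add: joint_basis_entry\<close>)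
  finally show ?thesis by (simp add: mult_ac)
qed

lemma vectorize_index:
  assumes "A \<in> carrier_mat N T" "i < N" "t < T"
  shows "vectorize A $ (N * t + i) = A $$ (i, t)"
  using assms stacked_index_less[of i N t T] by (simp add: vectorize_def)

text \<open>The Kronecker product of the two deltas is the delta at \<open>N * s + j\<close>, so
  localizing selects that column of the filter.\<close>

lemma vectorize_joint_localization:
  assumes "U \<in> carrier_mat N N" "i < N" "j < N" "t < T" "s < T"
  shows "vectorize (joint_localization N T U lam j s h) $ (N * t + i) =
    joint_filter N T U lam h $$ (N * t + i, N * s + j)"
proof -
  have "vectorize (joint_localization N T U lam j s h) $ (N * t + i) =
      joint_localization N T U lam j s h $$ (i, t)"
    by (rule vectorize_index) (use assms in \<open>simp_all add: joint_localization_def unvectorize_def\<close>)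
  also have "\<dots> = joint_filter N T U lam h $$ (N * t + i, N * s + j)"
    using assms joint_filter_carrier[OF assms(1), of T lam h]
    by (simp add: joint_localization_def unvectorize_def kronecker_unit_vec
        mult_mat_unit_vec_index stacked_index_less)
  finally show ?thesis .
qed

section \<open>Moments of single entries\<close>

definition entry_mean where
  "entry_mean M X i t = (\<integral>\<omega>. X \<omega> $$ (i, t) \<partial>M)"

definition entry_cov where
  "entry_cov M X i t j s =
    (\<integral>\<omega>. X \<omega> $$ (i, t) * X \<omega> $$ (j, s) \<partial>M) - entry_mean M X i t * entry_mean M X j s"

text \<open>Stacked vector, rows and columns share the same entry moments, which lets the joint
  hypotheses be transferred to the marginals. The shape of \<open>X \<omega>\<close> is known only
  on the sample space, so integrands are compared there.\<close>

lemma
  fixes X :: "'a \<Rightarrow> real Matrix.mat"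
  assumes carrier: "X \<in> space M \<rightarrow> carrier_mat N T"
  shows mean_vec_vectorize: "\<And>i t. i < N \<Longrightarrow> t < T \<Longrightarrow>
      mean_vec (N * T) M (\<lambda>\<omega>. vectorize (X \<omega>)) $ (N * t + i) = entry_mean M X i t"
    and mean_vec_row: "\<And>i t. i < N \<Longrightarrow> t < T \<Longrightarrow>
      mean_vec T M (\<lambda>\<omega>. Matrix.row (X \<omega>) i) $ t = entry_mean M X i t"
    and mean_vec_col: "\<And>i t. i < N \<Longrightarrow> t < T \<Longrightarrow>
      mean_vec N M (\<lambda>\<omega>. col (X \<omega>) t) $ i = entry_mean M X i t"
    and covariance_mat_vectorize: "\<And>i t j s. i < N \<Longrightarrow> t < T \<Longrightarrow> j < N \<Longrightarrow> s < T \<Longrightarrow>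
      covariance_mat (N * T) M (\<lambda>\<omega>. vectorize (X \<omega>)) $$ (N * t + i, N * s + j) =
        entry_cov M X i t j s"
    and covariance_mat_row: "\<And>i t s. i < N \<Longrightarrow> t < T \<Longrightarrow> s < T \<Longrightarrow>
      covariance_mat T M (\<lambda>\<omega>. Matrix.row (X \<omega>) i) $$ (t, s) = entry_cov M X i t i s"
    and covariance_mat_col: "\<And>i j t. i < N \<Longrightarrow> j < N \<Longrightarrow> t < T \<Longrightarrow>
      covariance_mat N M (\<lambda>\<omega>. col (X \<omega>) t) $$ (i, j) = entry_cov M X i t j t"
proof -
  have [simp]: "vectorize (X \<omega>) $ (N * t + i) = X \<omega> $$ (i, t)"
      "Matrix.row (X \<omega>) i $ t = X \<omega> $$ (i, t)" "col (X \<omega>) t $ i = X \<omega> $$ (i, t)"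
    if "\<omega> \<in> space M" "i < N" "t < T" for \<omega> i t
    using funcset_mem[OF carrier that(1)] that by (simp_all add: vectorize_index)
  note defs = mean_vec_def covariance_mat_def entry_mean_def entry_cov_def stacked_index_less
  show "mean_vec (N * T) M (\<lambda>\<omega>. vectorize (X \<omega>)) $ (N * t + i) = entry_mean M X i t"
    if "i < N" "t < T" for i t
    using that by (simp add: defs cong: Bochner_Integration.integral_cong)
  show "mean_vec T M (\<lambda>\<omega>. Matrix.row (X \<omega>) i) $ t = entry_mean M X i t"
    if "i < N" "t < T" for i t
    using that by (simp add: defs cong: Bochner_Integration.integral_cong)
  show "mean_vec N M (\<lambda>\<omega>. col (X \<omega>) t) $ i = entry_mean M X i t"
    if "i < N" "t < T" for i t
    using that by (simp add: defs cong: Bochner_Integration.integral_cong)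
  show "covariance_mat (N * T) M (\<lambda>\<omega>. vectorize (X \<omega>)) $$ (N * t + i, N * s + j) =
      entry_cov M X i t j s"
    if "i < N" "t < T" "j < N" "s < T" for i t j s
    using that by (simp add: defs cong: Bochner_Integration.integral_cong)
  show "covariance_mat T M (\<lambda>\<omega>. Matrix.row (X \<omega>) i) $$ (t, s) = entry_cov M X i t i s"
    if "i < N" "t < T" "s < T" for i t s
    using that by (simp add: defs cong: Bochner_Integration.integral_cong)
  show "covariance_mat N M (\<lambda>\<omega>. col (X \<omega>) t) $$ (i, j) = entry_cov M X i t j t"
    if "i < N" "j < N" "t < T" for i j t
    using that by (simp add: defs cong: Bochner_Integration.integral_cong)
qed

section \<open>From joint stationarity to stationarity in time and over vertices\<close>

theorem theorem2:
  fixes N T :: nat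
    and W :: "real Matrix.mat"
    and U :: "complex Matrix.mat"
    and lam :: "nat \<Rightarrow> real"
    and M :: "'a measure"
    and X :: "'a \<Rightarrow> real Matrix.mat"
  assumes "T \<ge> 1"
    and "weighted_graph N W"
    and "graph_eigenbasis N W U lam"
    and "joint_process N T M X"
    and "JWSS N T W U lam M X"
  shows "TWSS N T M X \<and> VWSS N T W U lam M X"
proof -
  have U: "U \<in> carrier_mat N N"
    using assms(3) by (simp add: graph_eigenbasis_def unitary_mat_def)
  have carrier: "X \<in> space M \<rightarrow> carrier_mat N T"
    using assms(4) by (simp add: joint_process_def)
  let ?m = "mean_vec (N * T) M (\<lambda>\<omega>. vectorize (X \<omega>))"
  let ?K = "covariance_mat (N * T) M (\<lambda>\<omega>. vectorize (X \<omega>))"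
  have m: "?m \<in> carrier_vec (N * T)" by (simp add: mean_vec_def)
  have m_zero: "joint_laplacian N T W *\<^sub>v map_vec complex_of_real ?m = 0\<^sub>v (N * T)"
    using assms(5) by (simp add: JWSS_def)
  have mean_const: "entry_mean M X i t = entry_mean M X i 0" if "i < N" "t < T" for i t
  proof -
    have "0 < T" using that by simp
    then show ?thesis
      using joint_laplacian_kernel(1)[OF assms(2) m m_zero that]
        mean_vec_vectorize[OF carrier that] mean_vec_vectorize[OF carrier that(1) \<open>0 < T\<close>]
      by simp
  qed
  have mean_harmonic: "(\<Sum>j<N. graph_laplacian N W $$ (i, j) * entry_mean M X j t) = 0"
    if "i < N" "t < T" for i t
    using joint_laplacian_kernel(2)[OF assms(2) m m_zero that] that
    by (simp add: mean_vec_vectorize[OF carrier])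
  obtain h where h: "\<And>i t. i < N \<Longrightarrow> t < T \<Longrightarrow>
      map_vec complex_of_real (Matrix.row ?K (N * t + i)) = vectorize (joint_localization N T U lam i t h)"
    using assms(5) unfolding JWSS_def by blast
  \<comment> \<open>A row of the covariance is a column of the filter, so the index pairs appear in
    reversed order. The exponent therefore carries \<open>s - t\<close>, as in
    \<open>time_localization T t\<close>.\<close>
  have cov: "complex_of_real (entry_cov M X i t j s) =
      (\<Sum>\<tau><T. \<Sum>n<N. of_real (h (lam n) (omega T \<tau>)) *
        (exp (2 * complex_of_real pi * \<i> * of_nat \<tau> * (of_nat s - of_nat t) / of_nat T) / of_nat T) *
        (U $$ (j, n) * cnj (U $$ (i, n))))"
    if "i < N" "j < N" "t < T" "s < T" for i j t s
  proof -
    have "complex_of_real (entry_cov M X i t j s) =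
        map_vec complex_of_real (Matrix.row ?K (N * t + i)) $ (N * s + j)"
      using that covariance_mat_vectorize[OF carrier that(1,3,2,4)]
      by (simp add: covariance_mat_def stacked_index_less)
    also have "\<dots> = joint_filter N T U lam h $$ (N * s + j, N * t + i)"
      unfolding h[OF that(1,3)] using that by (simp add: vectorize_joint_localization[OF U])
    finally show ?thesis
      using that by (simp add: joint_filter_entry[OF U] fourier_entry_mult_cnj)
  qed
  have "TWSS N T M X"
    unfolding TWSS_def
  proof (intro allI impI conjI)
    fix i assume i: "i < N"
    have "mean_vec T M (\<lambda>\<omega>. Matrix.row (X \<omega>) i) = entry_mean M X i 0 \<cdot>\<^sub>v ones_vec T"
    proof (rule eq_vecI)
      fix t assume "t < dim_vec (entry_mean M X i 0 \<cdot>\<^sub>v ones_vec T)"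
      then have t: "t < T" by (simp add: ones_vec_def)
      show "mean_vec T M (\<lambda>\<omega>. Matrix.row (X \<omega>) i) $ t = (entry_mean M X i 0 \<cdot>\<^sub>v ones_vec T) $ t"
        using t i mean_const[OF i t] by (simp add: mean_vec_row[OF carrier] ones_vec_def)
    qed (simp add: mean_vec_def ones_vec_def)
    then show "\<exists>c. mean_vec T M (\<lambda>\<omega>. Matrix.row (X \<omega>) i) = c \<cdot>\<^sub>v ones_vec T" by blast
    \<comment> \<open>For \<open>j = i\<close> the vertex factor in \<open>cov\<close> is a squared
      modulus. Hence \<open>\<gamma>\<close> is real-valued, as a time localization
      requires.\<close>
    define \<gamma> where "\<gamma> w = (\<Sum>n<N. h (lam n) w * (cmod (U $$ (i, n)))\<^sup>2)" for w
    show "\<exists>\<gamma>. \<forall>t<T. map_vec complex_of_real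
             (Matrix.row (covariance_mat T M (\<lambda>\<omega>. Matrix.row (X \<omega>) i)) t) = time_localization T t \<gamma>"
    proof (intro exI[of _ \<gamma>] allI impI eq_vecI)
      fix t s assume t: "t < T" and "s < dim_vec (time_localization T t \<gamma>)"
      then have s: "s < T" by (simp add: time_localization_def)
      have "map_vec complex_of_real
          (Matrix.row (covariance_mat T M (\<lambda>\<omega>. Matrix.row (X \<omega>) i)) t) $ s =
          complex_of_real (entry_cov M X i t i s)"
        using t s i covariance_mat_row[OF carrier i t s] by (simp add: covariance_mat_def)
      also have "\<dots> = time_localization T t \<gamma> $ s"
      proof -
        define E where "E \<tau> = exp (2 * complex_of_real pi * \<i> * of_nat \<tau> * (of_nat s - of_nat t) / of_nat T)"
          for \<tau>
        have "time_localization T t \<gamma> $ s =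
            1 / of_nat T * (\<Sum>\<tau><T. complex_of_real (\<gamma> (omega T \<tau>)) * E \<tau>)"
          using s by (simp add: time_localization_def E_def)
        also have "\<dots> = (\<Sum>\<tau><T. \<Sum>n<N. of_real (h (lam n) (omega T \<tau>)) * (E \<tau> / of_nat T) *
            (U $$ (i, n) * cnj (U $$ (i, n))))"
          by (simp add: \<gamma>_def complex_norm_square sum_distrib_left sum_distrib_right mult_ac
              del: of_real_power)
        finally show ?thesis
          unfolding cov[OF i i t s] E_def by (rule sym)
      qed
      finally show "map_vec complex_of_real
          (Matrix.row (covariance_mat T M (\<lambda>\<omega>. Matrix.row (X \<omega>) i)) t) $ s =
          time_localization T t \<gamma> $ s" .
    qed (simp add: covariance_mat_def time_localization_def)
  qed
  moreover have "VWSS N T W U lam M X"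
    unfolding VWSS_def
  proof (intro allI impI conjI)
    fix t assume t: "t < T"
    have L: "graph_laplacian N W \<in> carrier_mat N N"
      using assms(2) by (rule graph_laplacian_carrier)
    show "graph_laplacian N W *\<^sub>v mean_vec N M (\<lambda>\<omega>. col (X \<omega>) t) = 0\<^sub>v N"
    proof (rule eq_vecI)
      fix i assume "i < dim_vec (0\<^sub>v N :: real Matrix.vec)"
      then have i: "i < N" by simp
      have "(graph_laplacian N W *\<^sub>v mean_vec N M (\<lambda>\<omega>. col (X \<omega>) t)) $ i =
          (\<Sum>j<N. graph_laplacian N W $$ (i, j) * mean_vec N M (\<lambda>\<omega>. col (X \<omega>) t) $ j)"
        using L i by (simp add: scalar_prod_def atLeast0LessThan mean_vec_def)
      also have "\<dots> = 0"
        using mean_harmonic[OF i t] t by (simp add: mean_vec_col[OF carrier])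
      finally show "(graph_laplacian N W *\<^sub>v mean_vec N M (\<lambda>\<omega>. col (X \<omega>) t)) $ i = 0\<^sub>v N $ i"
        using i by simp
    qed (simp add: carrier_matD(1)[OF L])
    \<comment> \<open>At equal times the exponential in \<open>cov\<close> is 1, so only the average
      over the frequencies remains. The same filter serves every \<open>t\<close>.\<close>
    define s where "s l = (\<Sum>\<tau><T. h l (omega T \<tau>)) / real T" for l
    have F: "graph_filter N U lam s \<in> carrier_mat N N"
      using carrier_matD[OF U]
      by (intro carrier_matI) (simp_all add: graph_filter_def mat_adjoint_def mat_of_rows_def)
    show "\<exists>s. \<forall>i<N. map_vec complex_of_real
             (Matrix.row (covariance_mat N M (\<lambda>\<omega>. col (X \<omega>) t)) i) = graph_localization N U lam i s"
    proof (intro exI[of _ s] allI impI eq_vecI)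
      fix i j assume i: "i < N" and "j < dim_vec (graph_localization N U lam i s)"
      then have j: "j < N" using F by (simp add: graph_localization_def)
      have "map_vec complex_of_real
          (Matrix.row (covariance_mat N M (\<lambda>\<omega>. col (X \<omega>) t)) i) $ j =
          complex_of_real (entry_cov M X i t j t)"
        using t j i covariance_mat_col[OF carrier i j t] by (simp add: covariance_mat_def)
      also have "\<dots> = graph_filter N U lam s $$ (j, i)"
        \<comment> \<open>The exchange puts the eigenvalue index outermost; the inner sum over
          frequencies is then \<open>s (lam n)\<close>.\<close>
        unfolding cov[OF i j t t] graph_filter_def spectral_entry[OF U j i]
        by (subst sum.swap)
           (simp add: s_def sum_distrib_left sum_distrib_right sum_divide_distrib mult_ac)
      also have "\<dots> = graph_localization N U lam i s $ j"
        using F i j by (simp add: graph_localization_def mult_mat_unit_vec_index)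
      finally show "map_vec complex_of_real
          (Matrix.row (covariance_mat N M (\<lambda>\<omega>. col (X \<omega>) t)) i) $ j =
          graph_localization N U lam i s $ j" .
    qed (use F in \<open>simp add: covariance_mat_def graph_localization_def\<close>)
  qed
  ultimately show ?thesis ..
qed

end
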